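(* Let $R$ be a local ring, and let $\sigma: R\to R$ be a ring endomorphism. Then the following are equivalent: (1) $T_2(R,\sigma)$ is strongly clean. (2) For every $a\in 1+J(R)$ and $b\in J(R)$, the map $l_a-r_{\sigma(b)}: R\to R$ is surjective.
   Context: All rings are associative with identity $1$, not necessarily commutative. $J(R)$ and $U(R)$ denote the Jacobson radical and the group of units of $R$. A ring is local if it has exactly one maximal right ideal. A ring endomorphism $\sigma$ of $R$ satisfies $\sigma(1)=1$. For a ring $R$ and an endomorphism $\sigma$ of $R$, $T_n(R,\sigma)$ is the ring of all $n\times n$ upper triangular matrices over $R$ with entrywise addition and multiplication $(a_{ij})(b_{ij})=(c_{ij})$, where $c_{ij}=\sum_{k=i}^{n}a_{ik}\sigma^{k-i}(b_{kj})$ for $i\le j$. For $a\in R$, $l_a,r_a: R\to R$ are the additive group endomorphisms $l_a(r)=ar$, $r_a(r)=ra$; thus $(l_a-r_b)(r)=ar-rb$. An element $a$ of a ring $S$ is strongly clean if there exist an idempotent $e\in S$ and a unit $u\in S$ with $a=e+u$ and $eu=ue$. A ring is strongly clean if all its elements are strongly clean. *)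

theory Defs
  imports "HOL-Algebra.Ring" "HOL-Algebra.AbelCoset" "HOL-Algebra.RingHom"
begin

text \<open>Rings are the (not necessarily commutative) unital rings of \<^locale>\<open>ring\<close>.\<close>

locale right_ideal = additive_subgroup I R + ring R for I and R (structure) +
  assumes r_closed: "\<lbrakk>a \<in> I; x \<in> carrier R\<rbrakk> \<Longrightarrow> a \<otimes> x \<in> I"

locale maximal_right_ideal = right_ideal +
  assumes notcarr: "carrier R \<noteq> I"
    and maximal: "\<lbrakk>right_ideal J R; I \<subseteq> J; J \<subseteq> carrier R\<rbrakk> \<Longrightarrow> J = I \<or> J = carrier R"

locale local_ring = ring +
  assumes unique_maximal: "\<exists>!M. maximal_right_ideal M R"

text \<open>The intersection with the carrier only matters when there is no maximal right ideal,
  i.e. for the zero ring.\<close>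

definition jacobson_radical :: "('a, 'm) ring_scheme \<Rightarrow> 'a set"
  where "jacobson_radical R = carrier R \<inter> \<Inter>{M. maximal_right_ideal M R}"

definition strongly_clean :: "('a, 'm) ring_scheme \<Rightarrow> 'a \<Rightarrow> bool"
  where "strongly_clean S a \<longleftrightarrow>
    (\<exists>e\<in>carrier S. \<exists>u\<in>Units S.
       e \<otimes>\<^bsub>S\<^esub> e = e \<and> a = e \<oplus>\<^bsub>S\<^esub> u \<and> e \<otimes>\<^bsub>S\<^esub> u = u \<otimes>\<^bsub>S\<^esub> e)"

definition strongly_clean_ring :: "('a, 'm) ring_scheme \<Rightarrow> bool"
  where "strongly_clean_ring S \<longleftrightarrow> (\<forall>a\<in>carrier S. strongly_clean S a)"

text \<open>The ring \<open>T\<^sub>n(R,\<sigma>)\<close>. An upper triangular matrix is a function of its (1-based) row and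
  column index; it is \<open>\<zero>\<close> below the diagonal and, so that equality of matrices is equality
  of functions, also at all index pairs outside the \<open>n \<times> n\<close> range.\<close>

definition ut_index :: "nat \<Rightarrow> nat \<Rightarrow> nat \<Rightarrow> bool"
  where "ut_index n i j \<longleftrightarrow> 1 \<le> i \<and> i \<le> j \<and> j \<le> n"

definition skew_triangular_ring ::
    "nat \<Rightarrow> ('a, 'm) ring_scheme \<Rightarrow> ('a \<Rightarrow> 'a) \<Rightarrow> (nat \<Rightarrow> nat \<Rightarrow> 'a) ring"
  where "skew_triangular_ring n R \<sigma> =
    \<lparr> carrier = {A. \<forall>i j. if ut_index n i j then A i j \<in> carrier R else A i j = \<zero>\<^bsub>R\<^esub>},
      mult = (\<lambda>A B i j. if ut_index n i j
         then \<Oplus>\<^bsub>R\<^esub>k\<in>{i..n}. A i k \<otimes>\<^bsub>R\<^esub> (\<sigma> ^^ (k - i)) (B k j) else \<zero>\<^bsub>R\<^esub>),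
      one = (\<lambda>i j. if ut_index n i j \<and> i = j then \<one>\<^bsub>R\<^esub> else \<zero>\<^bsub>R\<^esub>),
      zero = (\<lambda>i j. \<zero>\<^bsub>R\<^esub>),
      add = (\<lambda>A B i j. A i j \<oplus>\<^bsub>R\<^esub> B i j) \<rparr>"

lemma funpow_ring_hom:
  assumes "ring R" "\<sigma> \<in> ring_hom R R"
  shows "\<sigma> ^^ m \<in> ring_hom R R"
proof (induction m)
  case 0
  then show ?case by (simp add: ring_hom_def)
next
  case (Suc m)
  then show ?case using assms ring_hom_trans[of "\<sigma> ^^ m" R R \<sigma> R] by (simp add: comp_def)
qed

lemma (in ring) finsum_hom:
  assumes "h \<in> ring_hom R R" "finite A" "f \<in> A \<rightarrow> carrier R"
  shows "h (\<Oplus>x\<in>A. f x) = (\<Oplus>x\<in>A. h (f x))"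
  using assms(2,3)
proof (induction A)
  case empty
  then show ?case using ring_hom_zero[OF assms(1) ring_axioms ring_axioms] by simp
next
  case (insert a A)
  moreover have "h x \<in> carrier R" if "x \<in> carrier R" for x
    using ring_hom_closed[OF assms(1) that] .
  ultimately show ?case
    using ring_hom_add[OF assms(1), of "f a" "finsum R f A"] by (auto simp: Pi_def)
qed

lemma (in ring) finsum_swap:
  assumes "finite A" "finite B" "\<And>x y. x \<in> A \<Longrightarrow> y \<in> B \<Longrightarrow> f x y \<in> carrier R"
  shows "(\<Oplus>x\<in>A. \<Oplus>y\<in>B. f x y) = (\<Oplus>y\<in>B. \<Oplus>x\<in>A. f x y)"
  using assms(1,3)
proof (induction A)
  case empty
  then show ?case by simp
next
  case (insert a A)
  have "(\<Oplus>x\<in>insert a A. \<Oplus>y\<in>B. f x y) = (\<Oplus>y\<in>B. f a y) \<oplus> (\<Oplus>y\<in>B. \<Oplus>x\<in>A. f x y)"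
    using insert by (simp add: Pi_def)
  also have "\<dots> = (\<Oplus>y\<in>B. f a y \<oplus> (\<Oplus>x\<in>A. f x y))"
    by (rule finsum_addf[symmetric]) (use insert in \<open>auto intro!: finsum_closed\<close>)
  also have "\<dots> = (\<Oplus>y\<in>B. \<Oplus>x\<in>insert a A. f x y)"
    by (rule finsum_cong') (use insert in \<open>auto simp: Pi_def\<close>)
  finally show ?case .
qed

lemma (in ring) skew_triangular_ring_is_ring:
  assumes \<sigma>: "\<sigma> \<in> ring_hom R R"
  shows "ring (skew_triangular_ring n R \<sigma>)"
proof -
  let ?T = "skew_triangular_ring n R \<sigma>"
  have pow: "\<sigma> ^^ m \<in> ring_hom R R" for m
    using funpow_ring_hom[OF ring_axioms \<sigma>] .
  have p_closed [simp]: "(\<sigma> ^^ m) x \<in> carrier R" if "x \<in> carrier R" for m x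
    using ring_hom_closed[OF pow that] .
  have p_add: "(\<sigma> ^^ m) (x \<oplus> y) = (\<sigma> ^^ m) x \<oplus> (\<sigma> ^^ m) y"
    if "x \<in> carrier R" "y \<in> carrier R" for m x y
    using ring_hom_add[OF pow that] .
  have p_mult: "(\<sigma> ^^ m) (x \<otimes> y) = (\<sigma> ^^ m) x \<otimes> (\<sigma> ^^ m) y"
    if "x \<in> carrier R" "y \<in> carrier R" for m x y
    using ring_hom_mult[OF pow that] .
  have p_one [simp]: "(\<sigma> ^^ m) \<one> = \<one>" for m
    using ring_hom_one[OF pow] .
  have p_zero [simp]: "(\<sigma> ^^ m) \<zero> = \<zero>" for m
    using ring_hom_zero[OF pow ring_axioms ring_axioms] .
  have entry [simp]: "A i j \<in> carrier R" if "A \<in> carrier ?T" for A i j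
    using that by (cases "ut_index n i j") (auto simp: skew_triangular_ring_def)
  have off: "A i j = \<zero>" if "A \<in> carrier ?T" "\<not> ut_index n i j" for A i j
    using that by (auto simp: skew_triangular_ring_def)
  have memI: "A \<in> carrier ?T"
    if "\<And>i j. A i j \<in> carrier R" "\<And>i j. \<not> ut_index n i j \<Longrightarrow> A i j = \<zero>" for A
    using that by (auto simp: skew_triangular_ring_def)
  have T_add: "(A \<oplus>\<^bsub>?T\<^esub> B) i j = A i j \<oplus> B i j" for A B i j
    by (simp add: skew_triangular_ring_def)
  have T_zero: "\<zero>\<^bsub>?T\<^esub> i j = \<zero>" for i j
    by (simp add: skew_triangular_ring_def)
  have T_one: "\<one>\<^bsub>?T\<^esub> i j = (if ut_index n i j \<and> i = j then \<one> else \<zero>)" for i j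
    by (simp add: skew_triangular_ring_def)
  have T_mult: "(A \<otimes>\<^bsub>?T\<^esub> B) i j =
      (if ut_index n i j then \<Oplus>k\<in>{i..n}. A i k \<otimes> (\<sigma> ^^ (k - i)) (B k j) else \<zero>)" for A B i j
    by (simp add: skew_triangular_ring_def)
  have mult_closed: "A \<otimes>\<^bsub>?T\<^esub> B \<in> carrier ?T"
    if "A \<in> carrier ?T" "B \<in> carrier ?T" for A B
    by (rule memI) (use that in \<open>auto simp: T_mult intro!: finsum_closed\<close>)
  have one_closed: "\<one>\<^bsub>?T\<^esub> \<in> carrier ?T"
    by (rule memI) (auto simp: T_one)
  show ?thesis
  proof (rule ringI)
    show "abelian_group ?T"
    proof (rule abelian_groupI)
      fix A assume A: "A \<in> carrier ?T"
      show "\<exists>B\<in>carrier ?T. B \<oplus>\<^bsub>?T\<^esub> A = \<zero>\<^bsub>?T\<^esub>"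
        by (rule bexI[of _ "\<lambda>i j. \<ominus> A i j"])
          (use A in \<open>auto intro!: ext memI simp: T_add T_zero l_neg off\<close>)
    qed (auto intro!: ext memI simp: T_add T_zero a_ac off)
    show "monoid ?T"
    proof (rule monoidI)
      fix A assume A: "A \<in> carrier ?T"
      show "\<one>\<^bsub>?T\<^esub> \<otimes>\<^bsub>?T\<^esub> A = A"
      proof (intro ext)
        fix i j
        show "(\<one>\<^bsub>?T\<^esub> \<otimes>\<^bsub>?T\<^esub> A) i j = A i j"
        proof (cases "ut_index n i j")
          case True
          then have i: "i \<in> {i..n}" "1 \<le> i" "i \<le> n" by (auto simp: ut_index_def)
          have "(\<Oplus>k\<in>{i..n}. \<one>\<^bsub>?T\<^esub> i k \<otimes> (\<sigma> ^^ (k - i)) (A k j))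
              = (\<Oplus>k\<in>{i..n}. if i = k then A k j else \<zero>)"
            by (rule finsum_cong') (use A i in \<open>auto simp: T_one ut_index_def\<close>)
          also have "\<dots> = A i j"
            by (rule finsum_singleton) (use A i in auto)
          finally show ?thesis using True by (simp add: T_mult)
        qed (use A in \<open>simp add: T_mult off\<close>)
      qed
      show "A \<otimes>\<^bsub>?T\<^esub> \<one>\<^bsub>?T\<^esub> = A"
      proof (intro ext)
        fix i j
        show "(A \<otimes>\<^bsub>?T\<^esub> \<one>\<^bsub>?T\<^esub>) i j = A i j"
        proof (cases "ut_index n i j")
          case True
          then have j: "j \<in> {i..n}" "1 \<le> j" "j \<le> n" by (auto simp: ut_index_def)
          have "(\<Oplus>k\<in>{i..n}. A i k \<otimes> (\<sigma> ^^ (k - i)) (\<one>\<^bsub>?T\<^esub> k j))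
              = (\<Oplus>k\<in>{i..n}. if j = k then A i k else \<zero>)"
            by (rule finsum_cong') (use A j in \<open>auto simp: T_one ut_index_def\<close>)
          also have "\<dots> = A i j"
            by (rule finsum_singleton) (use A j in auto)
          finally show ?thesis using True by (simp add: T_mult)
        qed (use A in \<open>simp add: T_mult off\<close>)
      qed
    next
      fix A B C assume A: "A \<in> carrier ?T" and B: "B \<in> carrier ?T" and C: "C \<in> carrier ?T"
      show "A \<otimes>\<^bsub>?T\<^esub> B \<otimes>\<^bsub>?T\<^esub> C = A \<otimes>\<^bsub>?T\<^esub> (B \<otimes>\<^bsub>?T\<^esub> C)"
      proof (intro ext)
        fix i j
        show "(A \<otimes>\<^bsub>?T\<^esub> B \<otimes>\<^bsub>?T\<^esub> C) i j = (A \<otimes>\<^bsub>?T\<^esub> (B \<otimes>\<^bsub>?T\<^esub> C)) i j"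
        proof (cases "ut_index n i j")
          case True
          then have i: "1 \<le> i" by (simp add: ut_index_def)
          define f where "f k l = A i l \<otimes> ((\<sigma> ^^ (l - i)) (B l k) \<otimes> (\<sigma> ^^ (k - i)) (C k j))" for k l
          have f [simp]: "f k l \<in> carrier R" for k l
            using A B C by (simp add: f_def)
          have f0: "f k l = \<zero>" if "k < l" for k l
            using that A C off[OF B, of l k] by (simp add: f_def ut_index_def)
          have fj: "f k l = \<zero>" if "\<not> ut_index n k j" for k l
            using that A B off[OF C, of k j] by (simp add: f_def)
          have "(A \<otimes>\<^bsub>?T\<^esub> B \<otimes>\<^bsub>?T\<^esub> C) i j
              = (\<Oplus>k\<in>{i..n}. (\<Oplus>l\<in>{i..n}. A i l \<otimes> (\<sigma> ^^ (l - i)) (B l k)) \<otimes> (\<sigma> ^^ (k - i)) (C k j))"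
            unfolding T_mult if_P[OF True]
            by (rule finsum_cong') (use A B C i in \<open>auto simp: ut_index_def intro!: finsum_closed\<close>)
          also have "\<dots> = (\<Oplus>k\<in>{i..n}. \<Oplus>l\<in>{i..n}. f k l)"
            by (rule finsum_cong')
              (use A B C in \<open>auto simp: finsum_ldistr m_assoc f_def Pi_def intro!: finsum_closed\<close>)
          also have "\<dots> = (\<Oplus>l\<in>{i..n}. \<Oplus>k\<in>{i..n}. f k l)"
            by (rule finsum_swap) auto
          also have "\<dots> = (\<Oplus>l\<in>{i..n}. A i l \<otimes> (\<sigma> ^^ (l - i)) ((B \<otimes>\<^bsub>?T\<^esub> C) l j))"
          proof (rule finsum_cong')
            fix l assume l: "l \<in> {i..n}"
            have "(\<Oplus>k\<in>{i..n}. f k l) = (\<Oplus>k\<in>{l..n}. f k l)"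
              by (rule add.finprod_mono_neutral_cong_right) (use l f0 in auto)
            also have "\<dots> = A i l \<otimes> (\<sigma> ^^ (l - i)) ((B \<otimes>\<^bsub>?T\<^esub> C) l j)"
            proof (cases "ut_index n l j")
              case True
              have eq: "(\<sigma> ^^ (l - i)) ((\<sigma> ^^ (k - l)) x) = (\<sigma> ^^ (k - i)) x" if "k \<in> {l..n}" for k x
              proof -
                have "k - i = (l - i) + (k - l)" using that l by auto
                then show ?thesis by (simp add: funpow_add)
              qed
              have "(\<sigma> ^^ (l - i)) ((B \<otimes>\<^bsub>?T\<^esub> C) l j)
                  = (\<Oplus>k\<in>{l..n}. (\<sigma> ^^ (l - i)) (B l k \<otimes> (\<sigma> ^^ (k - l)) (C k j)))"
                unfolding T_mult if_P[OF True]
                by (rule finsum_hom[OF pow]) (use B C in auto)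
              also have "\<dots> = (\<Oplus>k\<in>{l..n}. (\<sigma> ^^ (l - i)) (B l k) \<otimes> (\<sigma> ^^ (k - i)) (C k j))"
                by (rule finsum_cong') (use B C eq in \<open>auto simp: p_mult\<close>)
              finally show ?thesis
                using A B C by (simp add: finsum_rdistr f_def Pi_def)
            next
              case False
              have "(\<Oplus>k\<in>{l..n}. f k l) = (\<Oplus>k\<in>{l..n}. \<zero>)"
              proof (rule finsum_cong')
                fix k assume "k \<in> {l..n}"
                moreover have "1 \<le> l" "j \<le> n"
                  using l i True by (auto simp: ut_index_def)
                ultimately show "f k l = \<zero>" using False by (auto intro!: fj simp: ut_index_def)
              qed auto
              then show ?thesis using A False by (simp add: T_mult)
            qed
            finally show "(\<Oplus>k\<in>{i..n}. f k l) = A i l \<otimes> (\<sigma> ^^ (l - i)) ((B \<otimes>\<^bsub>?T\<^esub> C) l j)" .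
          qed (use A mult_closed[OF B C] in auto)
          also have "\<dots> = (A \<otimes>\<^bsub>?T\<^esub> (B \<otimes>\<^bsub>?T\<^esub> C)) i j"
            unfolding T_mult[of A] if_P[OF True] ..
          finally show ?thesis .
        qed (simp add: T_mult)
      qed
    qed (fact mult_closed one_closed)+
  next
    fix A B C assume ABC: "A \<in> carrier ?T" "B \<in> carrier ?T" "C \<in> carrier ?T"
    show "(A \<oplus>\<^bsub>?T\<^esub> B) \<otimes>\<^bsub>?T\<^esub> C = A \<otimes>\<^bsub>?T\<^esub> C \<oplus>\<^bsub>?T\<^esub> B \<otimes>\<^bsub>?T\<^esub> C"
      by (intro ext) (use ABC in \<open>simp add: T_mult T_add l_distr finsum_addf Pi_def\<close>)
    show "C \<otimes>\<^bsub>?T\<^esub> (A \<oplus>\<^bsub>?T\<^esub> B) = C \<otimes>\<^bsub>?T\<^esub> A \<oplus>\<^bsub>?T\<^esub> C \<otimes>\<^bsub>?T\<^esub> B"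
      by (intro ext) (use ABC in \<open>simp add: T_mult T_add p_add r_distr finsum_addf Pi_def\<close>)
  qed
qed

end

theory Submission
  imports Defs
begin

text \<open>Write \<open>J\<close> for the Jacobson radical. In a local ring \<open>J\<close> is the set of non-units, so the only
  idempotents are \<open>0\<close> and \<open>1\<close>, and a matrix \<open>A = (a v; 0 b)\<close> is a unit iff \<open>a\<close> and \<open>b\<close> are.
  If \<open>A\<close> or \<open>1 - A\<close> is a unit, then \<open>A\<close> is trivially strongly clean. Otherwise
  \<open>(a, b)\<close> lies in \<open>(1 + J) \<times> J\<close> or in \<open>J \<times> (1 + J)\<close>. In the first case an idempotent \<open>e\<close> with
  \<open>A - e\<close> a unit must be \<open>(0 x; 0 1)\<close>, and it commutes with \<open>A\<close> iff
  \<open>a x - x \<sigma>(b) = - v\<close>; so strong cleanness of all such \<open>A\<close> is surjectivity of \<open>l\<^sub>a - r\<^bsub>\<sigma>(b)\<^esub>\<close>.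
  Replacing \<open>(a, b)\<close> by \<open>(1 - a, 1 - b)\<close> changes the sign of this map and exchanges the two cases.\<close>

section \<open>Local rings\<close>

text \<open>Closure under additive inverses follows from absorption, since
  \<open>\<ominus> x\<close> is \<open>x \<otimes> (\<ominus> \<one>)\<close>.\<close>

lemma (in ring) right_idealI:
  assumes "I \<subseteq> carrier R" "\<zero> \<in> I"
    and "\<And>x y. x \<in> I \<Longrightarrow> y \<in> I \<Longrightarrow> x \<oplus> y \<in> I"
    and "\<And>a x. a \<in> I \<Longrightarrow> x \<in> carrier R \<Longrightarrow> a \<otimes> x \<in> I"
  shows "right_ideal I R"
proof -
  have "\<ominus> x \<in> I" if "x \<in> I" for x
  proof -
    have "x \<otimes> (\<ominus> \<one>) = \<ominus> x"
      using that assms(1) by (auto simp: r_minus)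
    then show ?thesis
      using assms(4)[OF that, of "\<ominus> \<one>"] by simp
  qed
  then have "additive_subgroup I R"
    by (intro additive_subgroup.intro add.subgroupI) (use assms in \<open>auto simp: a_inv_def\<close>)
  then show ?thesis
    using assms(4) ring_axioms by (simp add: right_ideal_def right_ideal_axioms_def)
qed

lemma (in ring) right_ideal_principal:
  assumes x: "x \<in> carrier R"
  shows "right_ideal ((\<lambda>y. x \<otimes> y) ` carrier R) R"
proof (rule right_idealI)
  show "\<zero> \<in> (\<lambda>y. x \<otimes> y) ` carrier R"
    by (rule image_eqI[of _ _ \<zero>]) (use x in auto)
  show "u \<oplus> v \<in> (\<lambda>y. x \<otimes> y) ` carrier R"
    if "u \<in> (\<lambda>y. x \<otimes> y) ` carrier R" "v \<in> (\<lambda>y. x \<otimes> y) ` carrier R" for u v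
    using that x by (auto simp flip: r_distr)
  show "u \<otimes> v \<in> (\<lambda>y. x \<otimes> y) ` carrier R"
    if "u \<in> (\<lambda>y. x \<otimes> y) ` carrier R" "v \<in> carrier R" for u v
    using that x by (auto simp: m_assoc)
qed (use x in auto)

lemma (in right_ideal) one_imp_carrier:
  assumes "\<one> \<in> I"
  shows "I = carrier R"
  using r_closed[OF assms] a_subset by auto

lemma (in ring) right_ideal_Union_chain:
  assumes C: "C \<noteq> {}" "\<And>I. I \<in> C \<Longrightarrow> right_ideal I R"
    and chain: "\<And>I I'. I \<in> C \<Longrightarrow> I' \<in> C \<Longrightarrow> I \<subseteq> I' \<or> I' \<subseteq> I"
  shows "right_ideal (\<Union>C) R"
proof (rule right_idealI)
  note add = right_ideal.axioms(1)[OF C(2)]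
  show "\<Union>C \<subseteq> carrier R"
    using additive_subgroup.a_subset[OF add] by blast
  show "\<zero> \<in> \<Union>C"
    using additive_subgroup.zero_closed[OF add] C(1) by blast
  show "x \<oplus> y \<in> \<Union>C" if xy: "x \<in> \<Union>C" "y \<in> \<Union>C" for x y
  proof -
    obtain I I' where I: "I \<in> C" "x \<in> I" and I': "I' \<in> C" "y \<in> I'"
      using xy by auto
    then show ?thesis
      using chain[OF I(1) I'(1)] additive_subgroup.a_closed[OF add] by blast
  qed
  show "a \<otimes> x \<in> \<Union>C" if "a \<in> \<Union>C" "x \<in> carrier R" for a x
    using that right_ideal.r_closed[OF C(2)] by blast
qed

text \<open>Zorn's lemma on the right ideals above \<open>I\<close> that avoid
  \<open>\<one>\<close>. Avoiding \<open>\<one>\<close> amounts to being proper and, unlike mere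
  properness, visibly passes to unions of chains.\<close>

lemma (in ring) exists_maximal_right_ideal:
  assumes I: "right_ideal I R" "\<one> \<notin> I"
  shows "\<exists>M. maximal_right_ideal M R \<and> I \<subseteq> M"
proof -
  let ?P = "{K. right_ideal K R \<and> \<one> \<notin> K \<and> I \<subseteq> K}"
  have "\<exists>M\<in>?P. \<forall>X\<in>?P. M \<subseteq> X \<longrightarrow> X = M"
  proof (rule subset_Zorn_nonempty)
    show "?P \<noteq> {}" using I by auto
    fix C assume C: "C \<noteq> {}" "subset.chain ?P C"
    then have C_sub: "C \<subseteq> ?P"
      and C_lin: "\<And>X Y. X \<in> C \<Longrightarrow> Y \<in> C \<Longrightarrow> X \<subseteq> Y \<or> Y \<subseteq> X"
      by (auto simp: subset_chain_def)
    have "right_ideal (\<Union>C) R"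
      by (rule right_ideal_Union_chain) (use C(1) C_sub C_lin in auto)
    then show "\<Union>C \<in> ?P" using C(1) C_sub by blast
  qed
  then obtain M where M: "right_ideal M R" "\<one> \<notin> M" "I \<subseteq> M"
    and max: "\<And>X. X \<in> ?P \<Longrightarrow> M \<subseteq> X \<Longrightarrow> X = M"
    by auto
  have "maximal_right_ideal M R"
  proof (intro maximal_right_ideal.intro maximal_right_ideal_axioms.intro)
    show "carrier R \<noteq> M" using M(2) by auto
    \<comment> \<open>Either \<open>J\<close> avoids \<open>\<one>\<close> and competes in the Zorn
      family, or it contains \<open>\<one>\<close> and is everything.\<close>
    show "J = M \<or> J = carrier R" if "right_ideal J R" "M \<subseteq> J" for J
      using max[of J] that M(3) right_ideal.one_imp_carrier[OF that(1)] by blast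
  qed (fact M(1))
  then show ?thesis using M(3) by blast
qed

section \<open>Units and idempotents of a local ring\<close>

context local_ring
begin

lemma jacobson_radical_maximal: "maximal_right_ideal (jacobson_radical R) R"
proof -
  obtain M where M: "maximal_right_ideal M R"
    and uniq: "\<forall>M'. maximal_right_ideal M' R \<longrightarrow> M' = M"
    by (rule ex1E[OF unique_maximal])
  interpret M: maximal_right_ideal M R by fact
  have "{M. maximal_right_ideal M R} = {M}" using M uniq by blast
  then have "jacobson_radical R = M"
    using M.a_subset by (auto simp: jacobson_radical_def)
  then show ?thesis using M by simp
qed

sublocale J: maximal_right_ideal "jacobson_radical R" R
  by (rule jacobson_radical_maximal)

lemma one_notin_jacobson_radical: "\<one> \<notin> jacobson_radical R"
  using J.one_imp_carrier J.notcarr by auto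

text \<open>If the principal right ideal of \<open>x\<close> missed \<open>\<one>\<close>, it would
  lie in a maximal right ideal, hence in the only one, the radical; but it contains \<open>x\<close>
  itself.\<close>

lemma right_inverse_of_notin_jacobson_radical:
  assumes x: "x \<in> carrier R" "x \<notin> jacobson_radical R"
  obtains y where "y \<in> carrier R" "x \<otimes> y = \<one>"
proof -
  have "\<one> \<in> (\<lambda>y. x \<otimes> y) ` carrier R"
  proof (rule ccontr)
    assume "\<not> ?thesis"
    then obtain M where M: "maximal_right_ideal M R" "(\<lambda>y. x \<otimes> y) ` carrier R \<subseteq> M"
      using exists_maximal_right_ideal[OF right_ideal_principal[OF x(1)]] by blast
    have "M = jacobson_radical R"
      using unique_maximal M(1) jacobson_radical_maximal by metis
    moreover have "x \<in> (\<lambda>y. x \<otimes> y) ` carrier R"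
      by (rule image_eqI[of _ _ \<one>]) (use x in auto)
    ultimately show False using M(2) x(2) by auto
  qed
  then show thesis using that by auto
qed

text \<open>The radical is known here only as a right ideal, so an element outside it has at first
  just a right inverse \<open>y\<close>. Once \<open>y\<close> is also outside the radical, it has a
  right inverse \<open>w\<close>, and then \<open>x = x \<otimes> (y \<otimes> w) = w\<close>, so
  \<open>y\<close> is a two-sided inverse.\<close>

lemma unit_iff_notin_jacobson_radical:
  assumes x: "x \<in> carrier R"
  shows "x \<in> Units R \<longleftrightarrow> x \<notin> jacobson_radical R"
proof
  assume u: "x \<in> Units R"
  show "x \<notin> jacobson_radical R"
  proof
    assume "x \<in> jacobson_radical R"
    then have "x \<otimes> inv x \<in> jacobson_radical R"
      using u by (intro J.r_closed) auto
    then show False using one_notin_jacobson_radical u by simp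
  qed
next
  assume xJ: "x \<notin> jacobson_radical R"
  then obtain y where y: "y \<in> carrier R" and xy: "x \<otimes> y = \<one>"
    using right_inverse_of_notin_jacobson_radical x by blast
  \<comment> \<open>Otherwise \<open>y \<otimes> x\<close> is in the radical, so
    \<open>\<one> \<ominus> y \<otimes> x\<close> is right invertible. But \<open>x\<close>
    annihilates it from the left because \<open>x \<otimes> y = \<one>\<close>; this forces
    \<open>x = \<zero>\<close>, which is in the radical.\<close>
  have yJ: "y \<notin> jacobson_radical R"
  proof
    assume "y \<in> jacobson_radical R"
    then have e: "y \<otimes> x \<in> jacobson_radical R"
      using x by (rule J.r_closed)
    have ec: "y \<otimes> x \<in> carrier R" "\<one> \<ominus> y \<otimes> x \<in> carrier R" using x y by auto
    have "\<one> \<ominus> y \<otimes> x \<notin> jacobson_radical R"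
    proof
      assume "\<one> \<ominus> y \<otimes> x \<in> jacobson_radical R"
      then have "(\<one> \<ominus> y \<otimes> x) \<oplus> y \<otimes> x \<in> jacobson_radical R"
        using e by (rule J.a_closed)
      moreover have "(\<one> \<ominus> y \<otimes> x) \<oplus> y \<otimes> x = \<one>"
        using ec by (simp add: minus_eq a_assoc l_neg)
      ultimately show False using one_notin_jacobson_radical by simp
    qed
    then obtain z where z: "z \<in> carrier R" "(\<one> \<ominus> y \<otimes> x) \<otimes> z = \<one>"
      using right_inverse_of_notin_jacobson_radical ec by blast
    have "x \<otimes> (\<one> \<ominus> y \<otimes> x) = x \<ominus> (x \<otimes> y) \<otimes> x"
      using x y by (simp add: minus_eq r_distr r_minus m_assoc)
    also have "\<dots> = \<zero>" using x xy by (simp add: minus_eq r_neg)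
    finally have "x \<otimes> (\<one> \<ominus> y \<otimes> x) = \<zero>" .
    then have "x \<otimes> ((\<one> \<ominus> y \<otimes> x) \<otimes> z) = \<zero>"
      using x ec(2) z(1) by (simp flip: m_assoc)
    then have "x = \<zero>" using z x by simp
    then show False using xJ J.zero_closed by simp
  qed
  then obtain w where w: "w \<in> carrier R" and yw: "y \<otimes> w = \<one>"
    using right_inverse_of_notin_jacobson_radical y by blast
  have "x = x \<otimes> (y \<otimes> w)" using x yw by simp
  also have "\<dots> = w" using x y w xy by (simp flip: m_assoc)
  finally show "x \<in> Units R" using x y xy yw by (auto simp: Units_def)
qed

text \<open>\<open>x\<close> and \<open>\<one> \<ominus> x\<close> cannot both be in the radical, as
  they add up to \<open>\<one>\<close>.\<close>

lemma one_minus_in_Units: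
  assumes x: "x \<in> jacobson_radical R"
  shows "\<one> \<ominus> x \<in> Units R"
proof -
  have xc: "x \<in> carrier R" using x J.a_subset by auto
  have "\<one> \<ominus> x \<notin> jacobson_radical R"
  proof
    assume "\<one> \<ominus> x \<in> jacobson_radical R"
    then have "(\<one> \<ominus> x) \<oplus> x \<in> jacobson_radical R"
      using x by (rule J.a_closed)
    moreover have "(\<one> \<ominus> x) \<oplus> x = \<one>"
      using xc by (simp add: minus_eq a_assoc l_neg)
    ultimately show False using one_notin_jacobson_radical by simp
  qed
  then show ?thesis using xc by (simp add: unit_iff_notin_jacobson_radical)
qed

text \<open>One of \<open>e\<close> and \<open>\<one> \<ominus> e\<close> is a unit, and it can be
  cancelled from \<open>e \<otimes> e = e \<otimes> \<one>\<close> or from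
  \<open>(\<one> \<ominus> e) \<otimes> e = \<zero>\<close>, respectively.\<close>

lemma idempotent_cases:
  assumes e: "e \<in> carrier R" "e \<otimes> e = e"
  shows "e = \<zero> \<or> e = \<one>"
proof (cases "e \<in> Units R")
  case True
  then show ?thesis using e Units_l_cancel[of e e \<one>] by auto
next
  case False
  then have "\<one> \<ominus> e \<in> Units R"
    using e one_minus_in_Units by (simp add: unit_iff_notin_jacobson_radical)
  moreover have "(\<one> \<ominus> e) \<otimes> e = (\<one> \<ominus> e) \<otimes> \<zero>"
    using e by (simp add: minus_eq l_distr l_minus r_neg)
  ultimately show ?thesis using e Units_l_cancel[of "\<one> \<ominus> e" e \<zero>] by auto
qed

text \<open>Links the coset notation of the theorem to the form in which the matrix lemmas state
  their hypotheses.\<close>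

lemma one_coset_jacobson_radical_iff:
  assumes a: "a \<in> carrier R"
  shows "a \<in> \<one> <+ jacobson_radical R \<longleftrightarrow> \<one> \<ominus> a \<in> jacobson_radical R"
proof
  assume "a \<in> \<one> <+ jacobson_radical R"
  then obtain h where h: "h \<in> jacobson_radical R" "a = \<one> \<oplus> h"
    by (auto simp: a_l_coset_def')
  then have "h \<in> carrier R" using J.a_subset by auto
  then have "\<one> \<ominus> a = \<ominus> h"
    using h(2) by (simp add: minus_eq minus_add r_neg2)
  then show "\<one> \<ominus> a \<in> jacobson_radical R" using h(1) by simp
next
  assume "\<one> \<ominus> a \<in> jacobson_radical R"
  then have "\<ominus> (\<one> \<ominus> a) \<in> jacobson_radical R" by simp
  moreover have "a = \<one> \<oplus> \<ominus> (\<one> \<ominus> a)"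
    using a by (simp add: minus_eq minus_add r_neg1 r_neg2)
  ultimately show "a \<in> \<one> <+ jacobson_radical R"
    by (auto simp: a_l_coset_def')
qed

end

section \<open>Strong cleanness and skew triangular matrices of size two\<close>

text \<open>The unit is determined by the idempotent as \<open>a \<ominus> e\<close>, and since
  \<open>e\<close> commutes with itself, commuting with this unit is the same as commuting with
  \<open>a\<close>.\<close>

lemma (in ring) strongly_clean_iff:
  assumes a: "a \<in> carrier R"
  shows "strongly_clean R a \<longleftrightarrow>
    (\<exists>e\<in>carrier R. e \<otimes> e = e \<and> a \<ominus> e \<in> Units R \<and> e \<otimes> a = a \<otimes> e)"
proof
  assume "strongly_clean R a"
  then obtain e u where e: "e \<in> carrier R" "e \<otimes> e = e" and u: "u \<in> Units R"
    and eu: "a = e \<oplus> u" "e \<otimes> u = u \<otimes> e"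
    by (auto simp: strongly_clean_def)
  have uc: "u \<in> carrier R" using u by auto
  have "a \<ominus> e = u" using e(1) uc eu(1) a_comm[of e u] by (simp add: minus_eq a_assoc r_neg)
  moreover have "e \<otimes> a = a \<otimes> e" using e uc eu by (simp add: l_distr r_distr)
  ultimately show "\<exists>e\<in>carrier R. e \<otimes> e = e \<and> a \<ominus> e \<in> Units R \<and> e \<otimes> a = a \<otimes> e"
    using e u by auto
next
  assume "\<exists>e\<in>carrier R. e \<otimes> e = e \<and> a \<ominus> e \<in> Units R \<and> e \<otimes> a = a \<otimes> e"
  then obtain e where e: "e \<in> carrier R" "e \<otimes> e = e" "a \<ominus> e \<in> Units R" "e \<otimes> a = a \<otimes> e"
    by auto
  have "a = e \<oplus> (a \<ominus> e)" using a e(1) by (simp add: minus_eq a_ac r_neg2 r_neg)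
  moreover have "e \<otimes> (a \<ominus> e) = (a \<ominus> e) \<otimes> e"
    using a e by (simp add: minus_eq l_distr r_distr l_minus r_minus)
  ultimately show "strongly_clean R a"
    using e unfolding strongly_clean_def by blast
qed

section \<open>Arithmetic of 2 x 2 skew triangular matrices over an arbitrary ring\<close>

definition ut2 :: "('a, 'm) ring_scheme \<Rightarrow> 'a \<Rightarrow> 'a \<Rightarrow> 'a \<Rightarrow> nat \<Rightarrow> nat \<Rightarrow> 'a"
  where "ut2 R a v b = (\<lambda>i j. if i = 1 \<and> j = 1 then a else if i = 1 \<and> j = 2 then v
    else if i = 2 \<and> j = 2 then b else \<zero>\<^bsub>R\<^esub>)"

lemma ut2_eq_iff [simp]: "ut2 R a v b = ut2 R a' v' b' \<longleftrightarrow> a = a' \<and> v = v' \<and> b = b'"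
proof
  assume "ut2 R a v b = ut2 R a' v' b'"
  then have "ut2 R a v b i j = ut2 R a' v' b' i j" for i j by simp
  from this[of 1 1] this[of 1 2] this[of 2 2] show "a = a' \<and> v = v' \<and> b = b'"
    by (auto simp: ut2_def)
qed simp

lemma ut_index_2: "ut_index 2 i j \<longleftrightarrow> i = 1 \<and> j = 1 \<or> i = 1 \<and> j = 2 \<or> i = 2 \<and> j = 2"
  by (auto simp: ut_index_def)

locale skew_triangular_2 = ring +
  fixes \<sigma> :: "'a \<Rightarrow> 'a"
  assumes \<sigma>: "\<sigma> \<in> ring_hom R R"
begin

abbreviation "T \<equiv> skew_triangular_ring 2 R \<sigma>"
abbreviation "tri \<equiv> ut2 R"

sublocale T: ring T
  by (rule skew_triangular_ring_is_ring[OF \<sigma>])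

lemma \<sigma>_closed [simp]: "x \<in> carrier R \<Longrightarrow> \<sigma> x \<in> carrier R"
  using ring_hom_closed[OF \<sigma>] .

lemma \<sigma>_one [simp]: "\<sigma> \<one> = \<one>"
  using ring_hom_one[OF \<sigma>] .

lemma \<sigma>_zero [simp]: "\<sigma> \<zero> = \<zero>"
  using ring_hom_zero[OF \<sigma> ring_axioms ring_axioms] .

lemma \<sigma>_mult: "x \<in> carrier R \<Longrightarrow> y \<in> carrier R \<Longrightarrow> \<sigma> (x \<otimes> y) = \<sigma> x \<otimes> \<sigma> y"
  using ring_hom_mult[OF \<sigma>] .

text \<open>Serves the passage from \<open>b\<close> to \<open>\<one> \<ominus> b\<close> under
  \<sigma>.\<close>

lemma \<sigma>_one_minus:
  assumes x: "x \<in> carrier R"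
  shows "\<sigma> (\<one> \<ominus> x) = \<one> \<ominus> \<sigma> x"
proof -
  have "\<sigma> (\<one> \<ominus> x) \<oplus> \<sigma> x = \<sigma> ((\<one> \<ominus> x) \<oplus> x)"
    using ring_hom_add[OF \<sigma>, of "\<one> \<ominus> x" x] x by simp
  also have "\<dots> = (\<one> \<ominus> \<sigma> x) \<oplus> \<sigma> x"
    using x by (simp add: minus_eq a_assoc l_neg)
  finally show ?thesis using x by (simp add: add.right_cancel)
qed

lemma tri_in_carrier [simp]:
  "tri a v b \<in> carrier T \<longleftrightarrow> a \<in> carrier R \<and> v \<in> carrier R \<and> b \<in> carrier R"
  (is "?L \<longleftrightarrow> ?R")
proof
  assume ?L
  then have "if ut_index 2 i j then tri a v b i j \<in> carrier R else tri a v b i j = \<zero>" for i j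
    by (simp add: skew_triangular_ring_def)
  from this[of 1 1] this[of 1 2] this[of 2 2] show ?R
    by (simp add: ut_index_2 ut2_def)
qed (auto simp: skew_triangular_ring_def ut_index_2 ut2_def)

lemma carrier_TE:
  assumes "A \<in> carrier T"
  obtains a v b where "a \<in> carrier R" "v \<in> carrier R" "b \<in> carrier R" "A = tri a v b"
proof (rule that)
  have *: "if ut_index 2 i j then A i j \<in> carrier R else A i j = \<zero>" for i j
    using assms by (simp add: skew_triangular_ring_def)
  show "A = tri (A 1 1) (A 1 2) (A 2 2)"
  proof (intro ext)
    show "A i j = tri (A 1 1) (A 1 2) (A 2 2) i j" for i j
      using *[of i j] by (auto simp: ut2_def ut_index_2 split: if_splits)
  qed
  show "A 1 1 \<in> carrier R" "A 1 2 \<in> carrier R" "A 2 2 \<in> carrier R"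
    using *[of 1 1] *[of 1 2] *[of 2 2] by (auto simp: ut_index_2)
qed

lemma tri_add [simp]:
  assumes "a \<in> carrier R" "v \<in> carrier R" "b \<in> carrier R"
    "a' \<in> carrier R" "v' \<in> carrier R" "b' \<in> carrier R"
  shows "tri a v b \<oplus>\<^bsub>T\<^esub> tri a' v' b' = tri (a \<oplus> a') (v \<oplus> v') (b \<oplus> b')"
  using assms by (auto simp: skew_triangular_ring_def ut2_def intro!: ext)

text \<open>The exponent \<open>k - i\<close> is positive only for \<open>i = 1\<close>,
  \<open>k = 2\<close>. There \<sigma> meets the second row of the right factor, whose entries are
  \<open>\<zero>\<close> and \<open>b'\<close>.\<close>

lemma tri_mult [simp]:
  assumes c: "a \<in> carrier R" "v \<in> carrier R" "b \<in> carrier R"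
    "a' \<in> carrier R" "v' \<in> carrier R" "b' \<in> carrier R"
  shows "tri a v b \<otimes>\<^bsub>T\<^esub> tri a' v' b' = tri (a \<otimes> a') (a \<otimes> v' \<oplus> v \<otimes> \<sigma> b') (b \<otimes> b')"
proof -
  have 12: "{Suc 0..2} = {Suc 0, 2}" by auto
  show ?thesis
    using c by (intro ext) (auto simp: skew_triangular_ring_def ut2_def ut_index_2 12)
qed

lemma tri_one: "\<one>\<^bsub>T\<^esub> = tri \<one> \<zero> \<one>"
  by (auto simp: skew_triangular_ring_def ut2_def ut_index_2 intro!: ext)

lemma tri_minus [simp]:
  assumes c: "a \<in> carrier R" "v \<in> carrier R" "b \<in> carrier R"
    "a' \<in> carrier R" "v' \<in> carrier R" "b' \<in> carrier R"
  shows "tri a v b \<ominus>\<^bsub>T\<^esub> tri a' v' b' = tri (a \<ominus> a') (v \<ominus> v') (b \<ominus> b')"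
proof -
  have "tri (a \<ominus> a') (v \<ominus> v') (b \<ominus> b') \<oplus>\<^bsub>T\<^esub> tri a' v' b' = tri a v b"
    using c by (simp add: minus_eq a_assoc l_neg)
  then have "tri a v b \<ominus>\<^bsub>T\<^esub> tri a' v' b'
      = (tri (a \<ominus> a') (v \<ominus> v') (b \<ominus> b') \<oplus>\<^bsub>T\<^esub> tri a' v' b') \<ominus>\<^bsub>T\<^esub> tri a' v' b'"
    by simp
  also have "\<dots> = tri (a \<ominus> a') (v \<ominus> v') (b \<ominus> b')"
    using c by (simp add: T.minus_eq T.a_assoc T.r_neg del: tri_add)
  finally show ?thesis .
qed

text \<open>The diagonal entries of a product are the products of the diagonal entries, so a matrix
  inverse yields inverses of \<open>a\<close> and \<open>b\<close>. The converse uses an explicit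
  inverse.\<close>

lemma tri_in_Units:
  assumes c: "a \<in> carrier R" "v \<in> carrier R" "b \<in> carrier R"
  shows "tri a v b \<in> Units T \<longleftrightarrow> a \<in> Units R \<and> b \<in> Units R"
proof
  assume "tri a v b \<in> Units T"
  then obtain B where B: "B \<in> carrier T" "tri a v b \<otimes>\<^bsub>T\<^esub> B = \<one>\<^bsub>T\<^esub>" "B \<otimes>\<^bsub>T\<^esub> tri a v b = \<one>\<^bsub>T\<^esub>"
    by (auto simp: Units_def)
  from B(1) obtain a' v' b' where "a' \<in> carrier R" "v' \<in> carrier R" "b' \<in> carrier R"
    "B = tri a' v' b'" by (rule carrier_TE)
  then show "a \<in> Units R \<and> b \<in> Units R"
    using B c by (auto simp: tri_one Units_def)
next
  assume u: "a \<in> Units R \<and> b \<in> Units R"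
  \<comment> \<open>This entry solves \<open>a \<otimes> ?w \<oplus> v \<otimes> \<sigma> (inv b) =
    \<zero>\<close>, the off-diagonal condition for a right inverse. It also meets the condition for
    a left inverse, because \<sigma> sends \<open>inv b \<otimes> b\<close> to
    \<open>\<one>\<close>.\<close>
  let ?w = "\<ominus> (inv a \<otimes> v \<otimes> \<sigma> (inv b))"
  have i: "inv a \<in> carrier R" "inv b \<in> carrier R" using u by auto
  have w: "?w \<in> carrier R" using i c by simp
  have "a \<otimes> ?w = \<ominus> (v \<otimes> \<sigma> (inv b))"
    using u c i by (simp add: r_minus flip: m_assoc)
  then have "a \<otimes> ?w \<oplus> v \<otimes> \<sigma> (inv b) = \<zero>"
    using c i by (simp add: l_neg)
  moreover have "?w \<otimes> \<sigma> b = \<ominus> (inv a \<otimes> v)"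
    using u c i by (simp add: l_minus m_assoc flip: \<sigma>_mult)
  then have "inv a \<otimes> v \<oplus> ?w \<otimes> \<sigma> b = \<zero>"
    using c i by (simp add: r_neg)
  ultimately have "tri a v b \<otimes>\<^bsub>T\<^esub> tri (inv a) ?w (inv b) = \<one>\<^bsub>T\<^esub>"
      "tri (inv a) ?w (inv b) \<otimes>\<^bsub>T\<^esub> tri a v b = \<one>\<^bsub>T\<^esub>"
    using u c i w by (simp_all add: tri_one)
  moreover have "tri (inv a) ?w (inv b) \<in> carrier T" "tri a v b \<in> carrier T"
    using c i w by simp_all
  ultimately show "tri a v b \<in> Units T" unfolding Units_def by blast
qed

text \<open>\<open>strongly_clean_iff\<close> in \<open>T\<close>, read off entrywise for the
  idempotent \<open>tri e x f\<close>. The entry \<open>x\<close> is constrained only by idempotency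
  and by commutation, since being a unit depends on the diagonal alone.\<close>

lemma strongly_clean_tri_iff:
  assumes c: "a \<in> carrier R" "v \<in> carrier R" "b \<in> carrier R"
  shows "strongly_clean T (tri a v b) \<longleftrightarrow>
    (\<exists>e\<in>carrier R. \<exists>x\<in>carrier R. \<exists>f\<in>carrier R.
       e \<otimes> e = e \<and> f \<otimes> f = f \<and> e \<otimes> x \<oplus> x \<otimes> \<sigma> f = x \<and>
       a \<ominus> e \<in> Units R \<and> b \<ominus> f \<in> Units R \<and>
       e \<otimes> a = a \<otimes> e \<and> f \<otimes> b = b \<otimes> f \<and> e \<otimes> v \<oplus> x \<otimes> \<sigma> b = a \<otimes> x \<oplus> v \<otimes> \<sigma> f)"
proof -
  have "strongly_clean T (tri a v b) \<longleftrightarrow>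
    (\<exists>E\<in>carrier T. E \<otimes>\<^bsub>T\<^esub> E = E \<and> tri a v b \<ominus>\<^bsub>T\<^esub> E \<in> Units T
        \<and> E \<otimes>\<^bsub>T\<^esub> tri a v b = tri a v b \<otimes>\<^bsub>T\<^esub> E)"
    using c by (intro T.strongly_clean_iff) simp
  also have "\<dots> \<longleftrightarrow> (\<exists>e\<in>carrier R. \<exists>x\<in>carrier R. \<exists>f\<in>carrier R.
      tri e x f \<otimes>\<^bsub>T\<^esub> tri e x f = tri e x f \<and> tri a v b \<ominus>\<^bsub>T\<^esub> tri e x f \<in> Units T
        \<and> tri e x f \<otimes>\<^bsub>T\<^esub> tri a v b = tri a v b \<otimes>\<^bsub>T\<^esub> tri e x f)"
    by (metis carrier_TE tri_in_carrier)
  finally show ?thesis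
    using c by (simp add: tri_in_Units conj_ac cong: bex_cong)
qed

end

section \<open>Strong cleanness over a local ring, according to the diagonal entries\<close>

locale local_skew_triangular_2 = local_ring R + skew_triangular_2 R \<sigma>
  for R (structure) and \<sigma>
begin

lemma one_minus_jacobson_radical:
  assumes x: "x \<in> carrier R" "\<one> \<ominus> x \<in> jacobson_radical R"
  shows "x \<in> Units R" "x \<ominus> \<one> \<in> jacobson_radical R"
proof -
  have "\<one> \<ominus> (\<one> \<ominus> x) = x"
    using x(1) by (simp add: minus_eq minus_add r_neg2)
  moreover have "\<ominus> (\<one> \<ominus> x) = x \<ominus> \<one>"
    using x(1) by (simp add: minus_eq minus_add a_comm)
  ultimately show "x \<in> Units R" "x \<ominus> \<one> \<in> jacobson_radical R"
    using one_minus_in_Units[OF x(2)] J.a_inv_closed[OF x(2)] by simp_all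
qed

text \<open>The radical is closed under negation. This adapts units
  \<open>\<one> \<ominus> x\<close> to the differences \<open>a \<ominus> e\<close> and
  \<open>b \<ominus> f\<close> in \<open>strongly_clean_tri_iff\<close>.\<close>

lemma minus_one_in_Units:
  assumes x: "x \<in> carrier R" "\<one> \<ominus> x \<in> Units R"
  shows "x \<ominus> \<one> \<in> Units R"
proof -
  have eq: "\<ominus> (x \<ominus> \<one>) = \<one> \<ominus> x"
    using x(1) by (simp add: minus_eq minus_add a_comm)
  have "x \<ominus> \<one> \<notin> jacobson_radical R"
    using J.a_inv_closed[of "x \<ominus> \<one>"] x unfolding eq
    by (auto simp: unit_iff_notin_jacobson_radical)
  then show ?thesis using x by (simp add: unit_iff_notin_jacobson_radical)
qed

text \<open>The idempotent is the zero matrix in the first case and the identity matrix in the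
  second.\<close>

lemma strongly_clean_tri_trivial:
  assumes c: "a \<in> carrier R" "v \<in> carrier R" "b \<in> carrier R"
    and "a \<in> Units R \<and> b \<in> Units R \<or> \<one> \<ominus> a \<in> Units R \<and> \<one> \<ominus> b \<in> Units R"
  shows "strongly_clean T (tri a v b)"
  using assms(4)
proof
  assume "a \<in> Units R \<and> b \<in> Units R"
  then show ?thesis
    unfolding strongly_clean_tri_iff[OF c] using c
    by (intro bexI[of _ \<zero>]) (auto simp: minus_eq)
next
  assume u: "\<one> \<ominus> a \<in> Units R \<and> \<one> \<ominus> b \<in> Units R"
  show ?thesis
    unfolding strongly_clean_tri_iff[OF c]
    by (rule bexI[of _ \<one>], rule bexI[of _ \<zero>], rule bexI[of _ \<one>])
      (use u c minus_one_in_Units in auto)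
qed

lemma strongly_clean_tri_one_zero:
  assumes c: "a \<in> carrier R" "v \<in> carrier R" "b \<in> carrier R"
    and a: "\<one> \<ominus> a \<in> jacobson_radical R" and b: "b \<in> jacobson_radical R"
  shows "strongly_clean T (tri a v b) \<longleftrightarrow>
    (\<exists>x\<in>carrier R. a \<otimes> x \<ominus> x \<otimes> \<sigma> b = \<ominus> v)"
proof
  assume "strongly_clean T (tri a v b)"
  then obtain e x f where x: "x \<in> carrier R" and e: "e \<in> carrier R" "e \<otimes> e = e"
    and f: "f \<in> carrier R" "f \<otimes> f = f"
    and u: "a \<ominus> e \<in> Units R" "b \<ominus> f \<in> Units R"
    and eq: "e \<otimes> v \<oplus> x \<otimes> \<sigma> b = a \<otimes> x \<oplus> v \<otimes> \<sigma> f"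
    unfolding strongly_clean_tri_iff[OF c] by blast
  \<comment> \<open>\<open>a \<ominus> \<one>\<close> is in the radical, so it cannot be the unit
    \<open>a \<ominus> e\<close>; likewise \<open>b\<close> cannot be the unit
    \<open>b \<ominus> f\<close> below.\<close>
  have "e \<noteq> \<one>"
    using u(1) one_minus_jacobson_radical(2)[OF c(1) a] c
    by (auto simp: unit_iff_notin_jacobson_radical)
  then have e0: "e = \<zero>" using idempotent_cases[OF e] by simp
  have "f \<noteq> \<zero>"
    using u(2) b c by (auto simp: unit_iff_notin_jacobson_radical minus_eq)
  then have f1: "f = \<one>" using idempotent_cases[OF f] by simp
  \<comment> \<open>With \<open>e = \<zero>\<close> and \<open>f = \<one>\<close>, the off-diagonal
    commutation equation loses two of its factors.\<close>
  have "x \<otimes> \<sigma> b = a \<otimes> x \<oplus> v" using eq c x by (simp add: e0 f1)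
  then have "a \<otimes> x \<ominus> x \<otimes> \<sigma> b = \<ominus> v"
    using c x by (simp add: minus_eq minus_add r_neg1 r_neg2)
  then show "\<exists>x\<in>carrier R. a \<otimes> x \<ominus> x \<otimes> \<sigma> b = \<ominus> v" using x by blast
next
  assume "\<exists>x\<in>carrier R. a \<otimes> x \<ominus> x \<otimes> \<sigma> b = \<ominus> v"
  then obtain x where x: "x \<in> carrier R" and eq: "a \<otimes> x \<ominus> x \<otimes> \<sigma> b = \<ominus> v" by blast
  have "x \<otimes> \<sigma> b = a \<otimes> x \<ominus> (a \<otimes> x \<ominus> x \<otimes> \<sigma> b)"
    using c x by (simp add: minus_eq minus_add r_neg1 r_neg2)
  also have "\<dots> = a \<otimes> x \<oplus> v" unfolding eq using c x by (simp add: minus_eq)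
  finally have eq': "x \<otimes> \<sigma> b = a \<otimes> x \<oplus> v" .
  have u: "a \<in> Units R" using one_minus_jacobson_radical(1) c a by simp
  have u': "b \<ominus> \<one> \<in> Units R"
    using minus_one_in_Units one_minus_in_Units c b by simp
  show "strongly_clean T (tri a v b)"
    unfolding strongly_clean_tri_iff[OF c]
    \<comment> \<open>The matrix \<open>tri \<zero> x \<one>\<close> is idempotent for every
      \<open>x\<close>; the choice of \<open>x\<close> makes it commute.\<close>
    by (rule bexI[of _ \<zero>], rule bexI[of _ x], rule bexI[of _ \<one>])
      (use u u' c x eq' in \<open>auto simp: minus_eq\<close>)
qed

text \<open>The left side of \<open>eq\<close> equals
  \<open>x \<otimes> \<sigma> b \<ominus> a \<otimes> x\<close>, so \<open>eq\<close> says
  \<open>v \<oplus> x \<otimes> \<sigma> b = a \<otimes> x\<close>. That is exactly commutation with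
  the idempotent \<open>tri \<one> x \<zero>\<close>.\<close>

lemma strongly_clean_tri_zero_one:
  assumes c: "a \<in> carrier R" "v \<in> carrier R" "b \<in> carrier R"
    and a: "a \<in> jacobson_radical R" and b: "\<one> \<ominus> b \<in> jacobson_radical R"
    and x: "x \<in> carrier R" and eq: "(\<one> \<ominus> a) \<otimes> x \<ominus> x \<otimes> \<sigma> (\<one> \<ominus> b) = \<ominus> v"
  shows "strongly_clean T (tri a v b)"
proof -
  have "(\<one> \<ominus> a) \<otimes> x = x \<ominus> a \<otimes> x" "x \<otimes> \<sigma> (\<one> \<ominus> b) = x \<ominus> x \<otimes> \<sigma> b"
    unfolding \<sigma>_one_minus[OF c(3)]
    using c x by (simp_all add: minus_eq l_distr r_distr l_minus r_minus)
  then have "\<ominus> v = (x \<ominus> a \<otimes> x) \<ominus> (x \<ominus> x \<otimes> \<sigma> b)" using eq by simp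
  also have "\<dots> = x \<otimes> \<sigma> b \<ominus> a \<otimes> x"
    using c x by (simp add: minus_eq minus_add a_ac r_neg1 r_neg2)
  finally have "\<ominus> (\<ominus> v) = a \<otimes> x \<ominus> x \<otimes> \<sigma> b"
    using c x by (simp add: minus_eq minus_add a_comm)
  then have eq': "v \<oplus> x \<otimes> \<sigma> b = a \<otimes> x"
    using c x by (simp add: minus_eq a_assoc l_neg)
  have u: "a \<ominus> \<one> \<in> Units R"
    using minus_one_in_Units one_minus_in_Units c a by simp
  have u': "b \<in> Units R" using one_minus_jacobson_radical(1) c b by simp
  show ?thesis
    unfolding strongly_clean_tri_iff[OF c]
    by (rule bexI[of _ \<one>], rule bexI[of _ x], rule bexI[of _ \<zero>])
      (use u u' c x eq' in \<open>auto simp: minus_eq\<close>)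
qed

end

theorem theorem2p1:
  fixes R :: "('a, 'm) ring_scheme" (structure) and \<sigma> :: "'a \<Rightarrow> 'a"
  assumes "local_ring R" and "\<sigma> \<in> ring_hom R R"
  shows "strongly_clean_ring (skew_triangular_ring 2 R \<sigma>) \<longleftrightarrow>
    (\<forall>a \<in> \<one> <+ jacobson_radical R. \<forall>b \<in> jacobson_radical R.
       (\<lambda>r. a \<otimes> r \<ominus> r \<otimes> \<sigma> b) ` carrier R = carrier R)"
proof -
  interpret local_ring R by fact
  interpret local_skew_triangular_2 R \<sigma>
    by unfold_locales (fact assms(2))
  show ?thesis
  proof (intro iffI ballI)
    fix a b assume clean: "strongly_clean_ring T"
      and a: "a \<in> \<one> <+ jacobson_radical R" and b: "b \<in> jacobson_radical R"
    have c: "a \<in> carrier R" "b \<in> carrier R"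
      using a b J.a_subset by (auto simp: a_l_coset_def')
    have "w \<in> (\<lambda>r. a \<otimes> r \<ominus> r \<otimes> \<sigma> b) ` carrier R" if w: "w \<in> carrier R" for w
    proof -
      \<comment> \<open>The corner entry is \<open>\<ominus> w\<close> because the equation of
        \<open>strongly_clean_tri_one_zero\<close> has the negated corner on its right side.\<close>
      have "strongly_clean T (tri a (\<ominus> w) b)"
        using clean c w by (simp add: strongly_clean_ring_def)
      then show ?thesis
        using strongly_clean_tri_one_zero[of a "\<ominus> w" b] a b c w one_coset_jacobson_radical_iff
        by auto
    qed
    then show "(\<lambda>r. a \<otimes> r \<ominus> r \<otimes> \<sigma> b) ` carrier R = carrier R"
      using c by auto
  next
    assume surj: "\<forall>a \<in> \<one> <+ jacobson_radical R. \<forall>b \<in> jacobson_radical R.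
       (\<lambda>r. a \<otimes> r \<ominus> r \<otimes> \<sigma> b) ` carrier R = carrier R"
    have sol: "\<exists>x\<in>carrier R. a \<otimes> x \<ominus> x \<otimes> \<sigma> b = w"
      if "a \<in> carrier R" "\<one> \<ominus> a \<in> jacobson_radical R" "b \<in> jacobson_radical R" "w \<in> carrier R"
      for a b w
    proof -
      have "w \<in> (\<lambda>r. a \<otimes> r \<ominus> r \<otimes> \<sigma> b) ` carrier R"
        using surj that by (simp add: one_coset_jacobson_radical_iff)
      then show ?thesis by auto
    qed
    show "strongly_clean_ring T"
      unfolding strongly_clean_ring_def
    proof
      fix A assume "A \<in> carrier T"
      then obtain a v b where c: "a \<in> carrier R" "v \<in> carrier R" "b \<in> carrier R"
        and A: "A = tri a v b" by (rule carrier_TE)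
      have unit: "y \<in> Units R \<or> y \<in> jacobson_radical R" if "y \<in> carrier R" for y
        using that unit_iff_notin_jacobson_radical by blast
      \<comment> \<open>Exhaustive: outside the first case \<open>a\<close> or \<open>b\<close> is
        in the radical. If \<open>a\<close> is, then \<open>\<one> \<ominus> a\<close> is a unit, so
        \<open>\<one> \<ominus> b\<close> is not and lies in the radical; symmetrically for
        \<open>b\<close>.\<close>
      consider "a \<in> Units R \<and> b \<in> Units R \<or> \<one> \<ominus> a \<in> Units R \<and> \<one> \<ominus> b \<in> Units R"
        | "\<one> \<ominus> a \<in> jacobson_radical R" "b \<in> jacobson_radical R"
        | "a \<in> jacobson_radical R" "\<one> \<ominus> b \<in> jacobson_radical R"
        using unit[of a] unit[of b] unit[of "\<one> \<ominus> a"] unit[of "\<one> \<ominus> b"] c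
          one_minus_in_Units[of a] one_minus_in_Units[of b] by auto
      then show "strongly_clean T A"
        unfolding A
      proof cases
        case 1
        then show "strongly_clean T (tri a v b)" using c by (rule strongly_clean_tri_trivial[rotated 3])
      next
        case 2
        then show "strongly_clean T (tri a v b)"
          using strongly_clean_tri_one_zero[of a v b] sol[of a b "\<ominus> v"] c by auto
      next
        case 3
        \<comment> \<open>Hence the pair \<open>\<one> \<ominus> a\<close>,
          \<open>\<one> \<ominus> b\<close> satisfies the hypotheses of \<open>sol\<close>.\<close>
        have "\<one> \<ominus> (\<one> \<ominus> a) = a"
          using c by (simp add: minus_eq minus_add r_neg2)
        then obtain x where "x \<in> carrier R" "(\<one> \<ominus> a) \<otimes> x \<ominus> x \<otimes> \<sigma> (\<one> \<ominus> b) = \<ominus> v"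
          using sol[of "\<one> \<ominus> a" "\<one> \<ominus> b" "\<ominus> v"] 3 c by auto
        then show "strongly_clean T (tri a v b)"
          using strongly_clean_tri_zero_one 3 c by blast
      qed
    qed
  qed
qed

end
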